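(* For any conjugate super-symmetric tensor $\mathcal{G}\in\mathbb{C}^{(2n)^d}$, we have $$\max_{\boldsymbol{x}\in\mathbb{C}^n,\ \boldsymbol{x}^{\mathrm{H}}\boldsymbol{x}=1} \bigg| \mathcal{G}\bigg( \underbrace{\binom{\overline{\boldsymbol{x}}}{\boldsymbol{x}}, \dots, \binom{\overline{\boldsymbol{x}}}{\boldsymbol{x}}}_d \bigg) \bigg| = \max_{\boldsymbol{x}^k\in\mathbb{C}^n,\ (\boldsymbol{x}^k)^{\mathrm{H}}\boldsymbol{x}^k=1,\ k=1,\dots,d}\mathrm{Re}\, \mathcal{G}\bigg( \binom{\overline{\boldsymbol{x}^1}}{\boldsymbol{x}^1}, \dots, \binom{\overline{\boldsymbol{x}^d}}{\boldsymbol{x}^d} \bigg).$$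
   Context: $\boldsymbol{x}^{\mathrm{H}}$ is the conjugate transpose of $\boldsymbol{x}$. For a tensor $\mathcal{G}\in\mathbb{C}^{(2n)^d}$, $\mathcal{G}(\boldsymbol{z}^1,\dots,\boldsymbol{z}^d)=\sum_{i_1,\dots,i_d=1}^{2n}\mathcal{G}_{i_1\dots i_d}z^1_{i_1}\cdots z^d_{i_d}$ is its multilinear form on $\boldsymbol{z}^k\in\mathbb{C}^{2n}$; $\binom{\overline{\boldsymbol{x}}}{\boldsymbol{x}}\in\mathbb{C}^{2n}$ is the stacked vector. The tensor $\mathcal{G}$ is conjugate super-symmetric if (i) its entries $\mathcal{G}_{i_1\dots i_d}$ are invariant under all permutations of the indices, and (ii) $\mathcal{G}_{i_1\dots i_d} = \overline{\mathcal{G}_{j_1\dots j_d }}$ for all $1\le i_1, \dots, i_d, j_1,\dots, j_d\le 2n$ with $|i_k -j_k| = n$ for $k=1,\dots,d$. *)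

theory Defs
  imports Complex_Main "HOL-Library.FuncSet" "HOL-Combinatorics.Permutations"
    "Jordan_Normal_Form.Matrix"
begin

text \<open>
  Indices are 0-based. A tensor of order \<open>d\<close> and dimension \<open>m\<close> in every mode is a function
  on multi-indices \<open>i \<in> multi_indices m d\<close>; its values elsewhere are never used.
\<close>

definition multi_indices :: "nat \<Rightarrow> nat \<Rightarrow> (nat \<Rightarrow> nat) set" where
  "multi_indices m d = {..<d} \<rightarrow>\<^sub>E {..<m}"

definition multilinear_form ::
  "nat \<Rightarrow> nat \<Rightarrow> ((nat \<Rightarrow> nat) \<Rightarrow> complex) \<Rightarrow> (nat \<Rightarrow> complex vec) \<Rightarrow> complex" where
  "multilinear_form m d G z = (\<Sum>i\<in>multi_indices m d. G i * (\<Prod>k<d. z k $ i k))"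

text \<open>
  For \<open>p permutes {..<d}\<close> and \<open>i \<in> multi_indices m d\<close>, the composition \<open>i \<circ> p\<close> is again in
  \<open>multi_indices m d\<close>, since \<open>p\<close> is the identity outside \<open>{..<d}\<close>.
\<close>

definition conjugate_super_symmetric ::
  "nat \<Rightarrow> nat \<Rightarrow> ((nat \<Rightarrow> nat) \<Rightarrow> complex) \<Rightarrow> bool" where
  "conjugate_super_symmetric n d G \<longleftrightarrow>
     (\<forall>i\<in>multi_indices (2 * n) d. \<forall>p. p permutes {..<d} \<longrightarrow> G (i \<circ> p) = G i) \<and>
     (\<forall>i\<in>multi_indices (2 * n) d. \<forall>j\<in>multi_indices (2 * n) d.
        (\<forall>k<d. \<bar>int (i k) - int (j k)\<bar> = int n) \<longrightarrow> G i = cnj (G j))"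

definition conj_stack :: "complex vec \<Rightarrow> complex vec" where
  "conj_stack x = conjugate x @\<^sub>v x"

definition complex_unit_sphere :: "nat \<Rightarrow> complex vec set" where
  "complex_unit_sphere n = {x \<in> carrier_vec n. conjugate x \<bullet> x = 1}"

definition is_maximum :: "real set \<Rightarrow> real \<Rightarrow> bool" where
  "is_maximum S M \<longleftrightarrow> M \<in> S \<and> (\<forall>y\<in>S. y \<le> M)"

end

theory Submission
  imports "HOL-Analysis.Function_Topology" Defs
begin

text \<open>
  On stacked vectors \<open>conj_stack x\<close> the form of a conjugate super-symmetric tensor takes real
  values: conjugating a stacked vector exchanges its two halves, and conjugating the entries of
  \<open>G\<close> exchanges them back (\<open>multilinear_form_conj_stack_real\<close>). Since stacking is
  additive and commutes with real scalars, the form becomes a symmetric real-multilinear form \<open>F\<close> on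
  $\mathbb{C}^n$ seen as a Euclidean space of dimension $2n$. The statement is therefore an instance
  of Banach's theorem: the maximum of \<open>\<bar>F\<bar>\<close> over tuples of unit vectors is attained at a constant
  tuple. The sign that the absolute value forgets is recovered by negating one entry.

  The proof of Banach's theorem rests on two variable slots at a time. If a tuple with unit entries
  \<open>x\<close> and \<open>y\<close> maximizes \<open>\<bar>F\<bar>\<close>, with maximum \<open>M\<close>, then, only these two slots being displayed, the
  polarization identity \<open>F(x+y, x+y) - F(x-y, x-y) = 4 F(x, y)\<close> and the parallelogram law
  \<open>\<parallel>x+y\<parallel>\<^sup>2 + \<parallel>x-y\<parallel>\<^sup>2 = 4\<close> meet the bounds \<open>\<bar>F(v, v)\<bar> \<le> M \<parallel>v\<parallel>\<^sup>2\<close>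
  with equality. So if \<open>x + y\<close> is not zero, both entries can be replaced by the normalized sum
  \<open>w = (x+y) / \<parallel>x+y\<parallel>\<close> without leaving the set of maximizers (\<open>merge_maximizer\<close>).

  Repeating this step would give a constant tuple only in the limit. Instead, compactness provides
  a maximizer that is extremal in a second sense: for a fixed unit vector \<open>e\<close> occurring in some
  maximizer, it has the largest sum of the real inner products of \<open>e\<close> with its entries. Sign changes
  show that these inner products are nonnegative and not all zero. If an entry differed from one
  with positive inner product, merging the two would multiply their joint contribution
  by \<open>2 / \<parallel>x+y\<parallel> > 1\<close>, a contradiction (\<open>constant_maximizer\<close>).
\<close>

section \<open>The Euclidean structure of complex vectors\<close>

definition re_inner :: "complex vec \<Rightarrow> complex vec \<Rightarrow> real" where
  "re_inner x y = Re (scalar_prod (conjugate x) y)"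

lemma re_inner_eq_sum:
  assumes "x \<in> carrier_vec n" "y \<in> carrier_vec n"
  shows "re_inner x y = (\<Sum>i<n. Re (cnj (x $ i) * y $ i))"
  using assms by (simp add: re_inner_def scalar_prod_def lessThan_atLeast0)

lemma re_inner_self_eq_sum:
  assumes "x \<in> carrier_vec n"
  shows "re_inner x x = (\<Sum>i<n. (cmod (x $ i))\<^sup>2)"
proof -
  have "Re (cnj z * z) = (cmod z)\<^sup>2" for z
    by (metis Re_complex_of_real complex_norm_square mult.commute of_real_power)
  then show ?thesis
    using assms by (simp only: re_inner_eq_sum)
qed

lemma complex_unit_sphere_iff:
  "x \<in> complex_unit_sphere n \<longleftrightarrow> x \<in> carrier_vec n \<and> re_inner x x = 1"
proof -
  have "scalar_prod (conjugate x) x = complex_of_real (re_inner x x)" if x: "x \<in> carrier_vec n"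
  proof -
    have "cnj z * z = complex_of_real ((cmod z)\<^sup>2)" for z
      by (metis complex_norm_square mult.commute of_real_power)
    then show ?thesis
      using x unfolding re_inner_self_eq_sum[OF x] of_real_sum
      by (simp add: scalar_prod_def lessThan_atLeast0)
  qed
  then show ?thesis
    by (auto simp: complex_unit_sphere_def)
qed

lemma re_inner_commute:
  assumes "x \<in> carrier_vec n" "y \<in> carrier_vec n"
  shows "re_inner x y = re_inner y x"
  using assms by (simp add: re_inner_eq_sum[where n = n] mult.commute)

lemma re_inner_add_right:
  assumes "x \<in> carrier_vec n" "y \<in> carrier_vec n" "z \<in> carrier_vec n"
  shows "re_inner x (y + z) = re_inner x y + re_inner x z"
  using assms by (simp add: re_inner_eq_sum[where n = n] algebra_simps flip: sum.distrib)

lemma re_inner_scale_right: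
  assumes "x \<in> carrier_vec n" "y \<in> carrier_vec n"
  shows "re_inner x (complex_of_real c \<cdot>\<^sub>v y) = c * re_inner x y"
  using assms by (simp add: re_inner_eq_sum[where n = n] sum_distrib_left algebra_simps)

lemma re_inner_add_left:
  assumes "x \<in> carrier_vec n" "y \<in> carrier_vec n" "z \<in> carrier_vec n"
  shows "re_inner (y + z) x = re_inner y x + re_inner z x"
  using assms re_inner_add_right[of x n y z] by (metis add_carrier_vec re_inner_commute)

lemma re_inner_scale_left:
  assumes "x \<in> carrier_vec n" "y \<in> carrier_vec n"
  shows "re_inner (complex_of_real c \<cdot>\<^sub>v y) x = c * re_inner y x"
  using assms re_inner_scale_right[of x n y c] by (metis smult_carrier_vec re_inner_commute)

lemma re_inner_self_nonneg:
  assumes "x \<in> carrier_vec n"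
  shows "0 \<le> re_inner x x"
  using assms by (simp add: re_inner_self_eq_sum sum_nonneg)

lemma re_inner_self_eq_0_iff:
  assumes "x \<in> carrier_vec n"
  shows "re_inner x x = 0 \<longleftrightarrow> x = 0\<^sub>v n"
  using assms by (auto simp: re_inner_self_eq_sum sum_nonneg_eq_0_iff)

lemma normalize_in_complex_unit_sphere:
  assumes x: "x \<in> carrier_vec n" and pos: "0 < re_inner x x"
  shows "complex_of_real (1 / sqrt (re_inner x x)) \<cdot>\<^sub>v x \<in> complex_unit_sphere n"
  using assms
  by (simp only: complex_unit_sphere_iff re_inner_scale_left[where n = n]
      re_inner_scale_right[where n = n] smult_carrier_vec) (simp add: field_simps)

text \<open>
  Negation is written as multiplication by a real scalar, the only kind of scalar that real-linear
  maps on complex vectors respect.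
\<close>

lemma complex_unit_sphere_uminus:
  assumes "x \<in> complex_unit_sphere n"
  shows "complex_of_real (-1) \<cdot>\<^sub>v x \<in> complex_unit_sphere n"
  using assms
  by (simp only: complex_unit_sphere_iff re_inner_scale_left[where n = n]
      re_inner_scale_right[where n = n] smult_carrier_vec) simp

text \<open>The parallelogram law for unit vectors; \<open>t\<close> is the difference of \<open>x\<close> and \<open>y\<close>.\<close>

lemma parallelogram_of_units:
  assumes "x \<in> complex_unit_sphere n" "y \<in> complex_unit_sphere n"
  defines "t \<equiv> x + complex_of_real (-1) \<cdot>\<^sub>v y"
  shows "re_inner (x + y) (x + y) + re_inner t t = 4"
proof -
  have car: "x \<in> carrier_vec n" "y \<in> carrier_vec n" "complex_of_real (-1) \<cdot>\<^sub>v y \<in> carrier_vec n"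
    and unit: "re_inner x x = 1" "re_inner y y = 1"
    using assms by (auto simp: complex_unit_sphere_iff)
  show ?thesis
    unfolding t_def
    by (simp only: re_inner_add_left[where n = n] re_inner_add_right[where n = n]
        re_inner_scale_left[where n = n] re_inner_scale_right[where n = n]
        car add_carrier_vec unit) simp
qed

text \<open>By the parallelogram law, since the difference is not zero.\<close>

lemma norm_sum_of_distinct_units:
  assumes x: "x \<in> complex_unit_sphere n" and y: "y \<in> complex_unit_sphere n" and "x \<noteq> y"
  shows "re_inner (x + y) (x + y) < 4"
proof -
  define t where "t = x + complex_of_real (-1) \<cdot>\<^sub>v y"
  have car: "x \<in> carrier_vec n" "y \<in> carrier_vec n" "t \<in> carrier_vec n"
    using x y by (auto simp: complex_unit_sphere_iff t_def)
  have "t \<noteq> 0\<^sub>v n"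
  proof
    assume t0: "t = 0\<^sub>v n"
    have "x $ i = y $ i" if "i < n" for i
      using arg_cong[OF t0, of "\<lambda>v. v $ i"] that car by (simp add: t_def)
    then show False
      using car \<open>x \<noteq> y\<close> by auto
  qed
  then have "0 < re_inner t t"
    using re_inner_self_nonneg[OF car(3)] re_inner_self_eq_0_iff[OF car(3)] by simp
  then show ?thesis
    using parallelogram_of_units[OF x y] by (simp add: t_def)
qed

section \<open>Compactness of the set of unit tuples\<close>

text \<open>
  Tychonoff's theorem is used twice: for the coordinates of one vector and for the entries of a tuple.
\<close>

lemma compact_PiE_UNIV:
  fixes S :: "'i \<Rightarrow> 'a::topological_space set"
  assumes "\<And>i. compact (S i)"
  shows "compact (Pi\<^sub>E UNIV S)"
  using assms compactin_PiE[of "\<lambda>_. euclidean" UNIV S]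
  by (simp add: euclidean_product_topology)

text \<open>
  The type \<open>complex vec\<close> carries no topology, so the unit sphere is represented by coordinate functions,
  whose type has the product topology. Only coordinates below \<open>n\<close> enter the norm; bounding
  the others too makes the set compact.
\<close>

definition coord_sphere :: "nat \<Rightarrow> (nat \<Rightarrow> complex) set" where
  "coord_sphere n =
     {x. (\<forall>i. \<bar>Re (x i)\<bar> \<le> 1 \<and> \<bar>Im (x i)\<bar> \<le> 1) \<and> (\<Sum>i<n. (cmod (x i))\<^sup>2) = 1}"

lemma compact_coord_sphere: "compact (coord_sphere n)"
proof -
  define Q where "Q = (\<lambda>(a, b). Complex a b) ` ({-1..1} \<times> {-1..1})"
  have Q: "z \<in> Q \<longleftrightarrow> \<bar>Re z\<bar> \<le> 1 \<and> \<bar>Im z\<bar> \<le> 1" for z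
    by (cases z) (auto simp: Q_def abs_le_iff image_iff)
  have "compact Q"
    unfolding Q_def Complex_eq case_prod_beta
    by (intro compact_continuous_image compact_Times compact_Icc continuous_intros)
  then have "compact ((UNIV :: nat set) \<rightarrow>\<^sub>E Q)"
    by (intro compact_PiE_UNIV)
  moreover have "continuous_on UNIV (\<lambda>x :: nat \<Rightarrow> complex. \<Sum>i<n. (cmod (x i))\<^sup>2)"
    by (intro continuous_intros continuous_on_product_coordinates)
  then have "closed {x :: nat \<Rightarrow> complex. (\<Sum>i<n. (cmod (x i))\<^sup>2) = 1}"
    by (intro closed_Collect_eq continuous_on_const)
  moreover have "coord_sphere n = (UNIV \<rightarrow>\<^sub>E Q) \<inter> {x. (\<Sum>i<n. (cmod (x i))\<^sup>2) = 1}"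
    by (auto simp: coord_sphere_def PiE_iff Q)
  ultimately show ?thesis
    by (simp add: compact_Int_closed)
qed

lemma vec_image_coord_sphere: "vec n ` coord_sphere n = complex_unit_sphere n"
proof (intro equalityI subsetI)
  fix x assume "x \<in> vec n ` coord_sphere n"
  then show "x \<in> complex_unit_sphere n"
    by (auto simp: complex_unit_sphere_iff coord_sphere_def re_inner_self_eq_sum[where n = n])
next
  fix x assume x: "x \<in> complex_unit_sphere n"
  then have car: "x \<in> carrier_vec n" and one: "(\<Sum>i<n. (cmod (x $ i))\<^sup>2) = 1"
    by (auto simp: complex_unit_sphere_iff re_inner_self_eq_sum[where n = n])
  define y where "y = (\<lambda>i. if i < n then x $ i else 0)"
  have "(cmod (x $ i))\<^sup>2 \<le> 1" if "i < n" for i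
    using that one member_le_sum[of i "{..<n}" "\<lambda>i. (cmod (x $ i))\<^sup>2"] by simp
  then have "cmod (y i) \<le> 1" for i
    by (simp add: y_def power_le_one_iff abs_square_le_1)
  then have "\<bar>Re (y i)\<bar> \<le> 1" "\<bar>Im (y i)\<bar> \<le> 1" for i
    using abs_Re_le_cmod abs_Im_le_cmod order_trans by blast+
  then have "y \<in> coord_sphere n"
    using one by (simp add: coord_sphere_def y_def)
  moreover have "x = vec n y"
    using car by (auto simp: y_def)
  ultimately show "x \<in> vec n ` coord_sphere n"
    by blast
qed

lemma complex_unit_sphere_nonempty:
  assumes "1 \<le> n"
  shows "unit_vec n 0 \<in> complex_unit_sphere n"
proof -
  have "(\<Sum>i<n. (cmod (unit_vec n 0 $ i))\<^sup>2) = (\<Sum>i<n. if i = 0 then 1 else 0)"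
    by (rule sum.cong) (auto simp: unit_vec_def)
  then show ?thesis
    using assms by (simp add: complex_unit_sphere_iff re_inner_self_eq_sum[where n = n] sum.delta)
qed

lemma continuous_on_coordinate:
  "continuous_on UNIV (\<lambda>X :: 'i \<Rightarrow> 'j \<Rightarrow> 'a::topological_space. X k a)"
  by (rule continuous_on_product_then_coordinatewise[OF continuous_on_product_coordinates])

section \<open>Banach's theorem on symmetric multilinear forms\<close>

text \<open>
  Tuples are functions on all natural numbers, of which the form is meant to use the first \<open>d\<close>.
  The scalars are real because the forms of interest are built from vectors together with their
  conjugates.
\<close>

locale symmetric_real_form =
  fixes n d :: nat and F :: "(nat \<Rightarrow> complex vec) \<Rightarrow> real"
  assumes add: "\<lbrakk>k < d; x \<in> carrier_vec n; y \<in> carrier_vec n\<rbrakk> \<Longrightarrow>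
      F (f(k := x + y)) = F (f(k := x)) + F (f(k := y))"
    and scale: "\<lbrakk>k < d; x \<in> carrier_vec n\<rbrakk> \<Longrightarrow>
      F (f(k := complex_of_real c \<cdot>\<^sub>v x)) = c * F (f(k := x))"
    and swap: "\<lbrakk>j < d; k < d; j \<noteq> k\<rbrakk> \<Longrightarrow> F (f(j := x, k := y)) = F (f(j := y, k := x))"
    and continuous: "continuous_on UNIV (\<lambda>X. F (\<lambda>k. vec n (X k)))"
begin

lemma add_first:
  assumes "j < d" "k < d" "j \<noteq> k" "x \<in> carrier_vec n" "y \<in> carrier_vec n"
  shows "F (f(j := x + y, k := z)) = F (f(j := x, k := z)) + F (f(j := y, k := z))"
  using add[of j x y "f(k := z)"] assms by (simp add: fun_upd_twist)

lemma scale_first: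
  assumes "j < d" "k < d" "j \<noteq> k" "x \<in> carrier_vec n"
  shows "F (f(j := complex_of_real c \<cdot>\<^sub>v x, k := z)) = c * F (f(j := x, k := z))"
  using scale[of j x "f(k := z)" c] assms by (simp add: fun_upd_twist)

lemma scale_both:
  assumes "j < d" "k < d" "j \<noteq> k" "x \<in> carrier_vec n"
  shows "F (f(j := complex_of_real c \<cdot>\<^sub>v x, k := complex_of_real c \<cdot>\<^sub>v x)) =
    c\<^sup>2 * F (f(j := x, k := x))"
  using assms by (simp add: scale_first scale power2_eq_square)

lemma polarization:
  assumes jk: "j < d" "k < d" "j \<noteq> k" and x: "x \<in> carrier_vec n" and y: "y \<in> carrier_vec n"
  defines "t \<equiv> x + complex_of_real (-1) \<cdot>\<^sub>v y"
  shows "F (f(j := x + y, k := x + y)) - F (f(j := t, k := t)) = 4 * F (f(j := x, k := y))"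
proof -
  have my: "complex_of_real (-1) \<cdot>\<^sub>v y \<in> carrier_vec n"
    using y by simp
  show ?thesis
    unfolding t_def
    by (simp only: add_first[OF jk] add[OF jk(2)] scale_first[OF jk] scale[OF jk(2)]
        x y my add_carrier_vec swap[OF jk, of f y x]) simp
qed

text \<open>By homogeneity, a bound on unit tuples extends quadratically to a vector that fills two slots.\<close>

lemma diagonal_bound:
  assumes jk: "j < d" "k < d" "j \<noteq> k" and v: "v \<in> carrier_vec n"
    and f: "\<And>l. f l \<in> complex_unit_sphere n"
    and M: "\<And>g. (\<And>l. g l \<in> complex_unit_sphere n) \<Longrightarrow> \<bar>F g\<bar> \<le> M"
  shows "\<bar>F (f(j := v, k := v))\<bar> \<le> M * re_inner v v"
proof (cases "re_inner v v = 0")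
  case True
  then have "v = complex_of_real 0 \<cdot>\<^sub>v v"
    using v by (auto simp: re_inner_self_eq_0_iff)
  then have "F (f(j := v, k := v)) = 0"
    using scale_both[OF jk v, of f 0] by simp
  with True show ?thesis
    by simp
next
  case False
  then have pos: "0 < re_inner v v"
    using re_inner_self_nonneg[OF v] by simp
  define u where "u = complex_of_real (1 / sqrt (re_inner v v)) \<cdot>\<^sub>v v"
  have "u \<in> complex_unit_sphere n"
    unfolding u_def by (rule normalize_in_complex_unit_sphere[OF v pos])
  then have "\<bar>F (f(j := u, k := u))\<bar> \<le> M"
    using f by (intro M) simp
  moreover have "F (f(j := u, k := u)) = F (f(j := v, k := v)) / re_inner v v"
    unfolding u_def scale_both[OF jk v] using pos by (simp add: power_divide)
  ultimately show ?thesis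
    using pos by (simp add: field_simps)
qed

text \<open>
  Let \<open>t\<close> be the difference of the two entries. The polarization identity expresses a number of
  modulus \<open>4 M\<close> by the values at \<open>s\<close> and \<open>t\<close>, whose bounds add up to
  \<open>M (\<parallel>s\<parallel>\<^sup>2 + \<parallel>t\<parallel>\<^sup>2) = 4 M\<close>. Hence the value at \<open>s\<close> attains its bound.
\<close>

lemma merge_maximizer:
  assumes jk: "j < d" "k < d" "j \<noteq> k"
    and f: "\<And>l. f l \<in> complex_unit_sphere n"
    and M: "\<And>g. (\<And>l. g l \<in> complex_unit_sphere n) \<Longrightarrow> \<bar>F g\<bar> \<le> M"
    and max: "\<bar>F f\<bar> = M"
  defines "s \<equiv> f j + f k"
  assumes pos: "0 < re_inner s s"
  defines "w \<equiv> complex_of_real (1 / sqrt (re_inner s s)) \<cdot>\<^sub>v s"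
  shows "\<bar>F (f(j := w, k := w))\<bar> = M"
proof -
  define t where "t = f j + complex_of_real (-1) \<cdot>\<^sub>v f k"
  have car: "f l \<in> carrier_vec n" for l
    using f[of l] by (auto simp: complex_unit_sphere_iff)
  have s: "s \<in> carrier_vec n" and t: "t \<in> carrier_vec n"
    using car by (auto simp: s_def t_def)
  have parallelogram: "re_inner s s + re_inner t t = 4"
    unfolding s_def t_def by (rule parallelogram_of_units[OF f f])
  have "F (f(j := s, k := s)) - F (f(j := t, k := t)) = 4 * F (f(j := f j, k := f k))"
    unfolding s_def t_def by (rule polarization[OF jk car car])
  then have "4 * M \<le> \<bar>F (f(j := s, k := s))\<bar> + \<bar>F (f(j := t, k := t))\<bar>"
    using max by simp
  also have "\<dots> \<le> \<bar>F (f(j := s, k := s))\<bar> + M * re_inner t t"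
    using diagonal_bound[OF jk t f M] by simp
  finally have "M * re_inner s s \<le> \<bar>F (f(j := s, k := s))\<bar>"
    using arg_cong[OF parallelogram, of "\<lambda>a. M * a"] by (simp add: algebra_simps)
  moreover have "F (f(j := w, k := w)) = F (f(j := s, k := s)) / re_inner s s"
    unfolding w_def scale_both[OF jk s] using pos by (simp add: power_divide)
  ultimately have "M \<le> \<bar>F (f(j := w, k := w))\<bar>"
    using pos by (simp add: abs_divide pos_le_divide_eq)
  moreover have "\<bar>F (f(j := w, k := w))\<bar> \<le> M"
    using f normalize_in_complex_unit_sphere[OF s pos] by (intro M) (simp add: w_def)
  ultimately show ?thesis
    by simp
qed

definition maximizers :: "(nat \<Rightarrow> complex vec) set" where
  "maximizers = {f. (\<forall>k. f k \<in> complex_unit_sphere n) \<and>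
     (\<forall>g. (\<forall>k. g k \<in> complex_unit_sphere n) \<longrightarrow> \<bar>F g\<bar> \<le> \<bar>F f\<bar>)}"

lemma maximizers_flip:
  assumes f: "f \<in> maximizers" and k: "k < d"
  shows "f(k := complex_of_real (-1) \<cdot>\<^sub>v f k) \<in> maximizers"
proof -
  have "\<bar>F (f(k := complex_of_real (-1) \<cdot>\<^sub>v f k))\<bar> = \<bar>F f\<bar>"
    using f k scale[of k "f k" f "-1"] by (auto simp: maximizers_def complex_unit_sphere_iff)
  then show ?thesis
    using f complex_unit_sphere_uminus by (auto simp: maximizers_def)
qed

text \<open>
  The compact set is the part of the compact set of all unit tuples on which the continuous function
  \<open>\<bar>F\<bar>\<close> takes its maximal value.
\<close>

lemma maximizers_compact_image:
  assumes "1 \<le> n"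
  obtains L :: "(nat \<Rightarrow> nat \<Rightarrow> complex) set"
  where "compact L" "L \<noteq> {}" "(\<lambda>X k. vec n (X k)) ` L = maximizers"
proof -
  define K where "K = (UNIV :: nat set) \<rightarrow>\<^sub>E coord_sphere n"
  define V where "V = (\<lambda>X :: nat \<Rightarrow> nat \<Rightarrow> complex. \<lambda>k. vec n (X k))"
  have K: "compact K"
    unfolding K_def by (intro compact_PiE_UNIV compact_coord_sphere)
  have V_image: "V ` K = {f. \<forall>k. f k \<in> complex_unit_sphere n}"
  proof (intro equalityI subsetI)
    fix f assume "f \<in> V ` K"
    then show "f \<in> {f. \<forall>k. f k \<in> complex_unit_sphere n}"
      by (auto simp: V_def K_def PiE_iff simp flip: vec_image_coord_sphere)
  next
    fix f :: "nat \<Rightarrow> complex vec"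
    assume "f \<in> {f. \<forall>k. f k \<in> complex_unit_sphere n}"
    then have "\<forall>k. \<exists>x. x \<in> coord_sphere n \<and> f k = vec n x"
      by (auto simp flip: vec_image_coord_sphere)
    then obtain X where "\<forall>k. X k \<in> coord_sphere n \<and> f k = vec n (X k)"
      by metis
    then have "X \<in> K" "f = V X"
      by (auto simp: V_def K_def)
    then show "f \<in> V ` K"
      by blast
  qed
  have "(\<lambda>_. unit_vec n 0) \<in> V ` K"
    using complex_unit_sphere_nonempty[OF assms] by (simp add: V_image)
  then have "K \<noteq> {}"
    by blast
  have cont: "continuous_on UNIV (\<lambda>X. \<bar>F (V X)\<bar>)"
    unfolding V_def by (intro continuous_intros continuous)
  obtain X where X: "X \<in> K" "\<And>Y. Y \<in> K \<Longrightarrow> \<bar>F (V Y)\<bar> \<le> \<bar>F (V X)\<bar>"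
    using continuous_attains_sup[OF K \<open>K \<noteq> {}\<close> continuous_on_subset[OF cont]] by blast
  have "V X \<in> maximizers"
  proof -
    have "V X \<in> V ` K"
      using X(1) by blast
    moreover have "\<bar>F g\<bar> \<le> \<bar>F (V X)\<bar>" if "g \<in> V ` K" for g
      using that X(2) by blast
    ultimately show ?thesis
      unfolding V_image maximizers_def by simp
  qed
  define L where "L = K \<inter> {Y. \<bar>F (V Y)\<bar> = \<bar>F (V X)\<bar>}"
  have "compact L"
    unfolding L_def by (intro compact_Int_closed K closed_Collect_eq cont continuous_on_const)
  have "X \<in> L"
    using X by (simp add: L_def)
  have L_image: "V ` L = maximizers"
  proof (intro equalityI subsetI)
    fix f assume "f \<in> V ` L"
    then show "f \<in> maximizers"
      using \<open>V X \<in> maximizers\<close> V_image unfolding L_def maximizers_def by auto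
  next
    fix f assume f: "f \<in> maximizers"
    then obtain Y where "Y \<in> K" "f = V Y"
      using V_image unfolding maximizers_def by blast
    moreover have "\<bar>F f\<bar> = \<bar>F (V X)\<bar>"
      using f \<open>V X \<in> maximizers\<close> unfolding maximizers_def by (auto intro: antisym)
    ultimately show "f \<in> V ` L"
      by (simp add: L_def)
  qed
  show thesis
    using that \<open>compact L\<close> \<open>X \<in> L\<close> L_image unfolding V_def by blast
qed

lemma maximizers_nonempty:
  assumes "1 \<le> n"
  shows "maximizers \<noteq> {}"
  by (rule maximizers_compact_image[OF assms]) auto

text \<open>
  The sum measures how well a tuple is aligned with \<open>e\<close>. It singles out a constant tuple
  among the maximizers.
\<close>

lemma best_aligned_maximizer:
  assumes "1 \<le> n" and e: "e \<in> carrier_vec n"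
  shows "\<exists>f\<in>maximizers. \<forall>g\<in>maximizers.
    (\<Sum>k<d. re_inner e (g k)) \<le> (\<Sum>k<d. re_inner e (f k))"
proof -
  obtain L :: "(nat \<Rightarrow> nat \<Rightarrow> complex) set"
    where L: "compact L" "L \<noteq> {}" "(\<lambda>X k. vec n (X k)) ` L = maximizers"
    using maximizers_compact_image[OF \<open>1 \<le> n\<close>] .
  have "re_inner e (vec n x) = (\<Sum>i<n. Re (cnj (e $ i) * x i))" for x
    using e by (simp add: re_inner_eq_sum[where n = n])
  then have "continuous_on UNIV (\<lambda>X :: nat \<Rightarrow> nat \<Rightarrow> complex. \<Sum>k<d. re_inner e (vec n (X k)))"
    by (simp only:) (intro continuous_on_Re continuous_on_sum continuous_on_mult
        continuous_on_const continuous_on_coordinate)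
  then have "\<exists>X\<in>L. \<forall>Y\<in>L.
      (\<Sum>k<d. re_inner e (vec n (Y k))) \<le> (\<Sum>k<d. re_inner e (vec n (X k)))"
    by (rule continuous_attains_sup[OF L(1,2) continuous_on_subset[OF _ subset_UNIV]])
  then show ?thesis
    unfolding L(3)[symmetric] by simp
qed

text \<open>
  Negating entries one by one moves the first \<open>m\<close> of them to the half-space of vectors that have a
  nonnegative inner product with \<open>e\<close>. Entries from \<open>m\<close> on are kept to make the induction go through.
\<close>

lemma maximizer_in_half_space:
  assumes f: "f \<in> maximizers" and e: "e \<in> carrier_vec n" and "m \<le> d"
  shows "\<exists>g\<in>maximizers. (\<forall>k<m. re_inner e (g k) = \<bar>re_inner e (f k)\<bar>) \<and> (\<forall>k\<ge>m. g k = f k)"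
  using \<open>m \<le> d\<close>
proof (induction m)
  case 0
  then show ?case
    using f by auto
next
  case (Suc m)
  then obtain g where g: "g \<in> maximizers" "\<And>k. k < m \<Longrightarrow> re_inner e (g k) = \<bar>re_inner e (f k)\<bar>"
      "\<And>k. k \<ge> m \<Longrightarrow> g k = f k"
    by auto
  show ?case
  proof (cases "0 \<le> re_inner e (f m)")
    case True
    then show ?thesis
      using g by (intro bexI[of _ g]) (auto simp: less_Suc_eq)
  next
    case False
    have fm: "f m \<in> carrier_vec n"
      using f by (auto simp: maximizers_def complex_unit_sphere_iff)
    have "g(m := complex_of_real (-1) \<cdot>\<^sub>v g m) \<in> maximizers"
      using Suc.prems by (intro maximizers_flip g(1)) simp
    then show ?thesis
      using g False re_inner_scale_right[OF e fm, of "-1"]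
      by (intro bexI[of _ "g(m := complex_of_real (-1) \<cdot>\<^sub>v g m)"]) (auto simp: less_Suc_eq)
  qed
qed

text \<open>
  Banach's theorem. Among all maximizers, the one that is best aligned with \<open>e\<close> cannot have two
  distinct entries, one of them with a positive inner product with \<open>e\<close>: merging them would improve the
  alignment. Taking \<open>e\<close> from a maximizer makes the best alignment positive, so that such an
  entry exists.
\<close>

theorem constant_maximizer:
  assumes "1 \<le> n" "1 \<le> d"
  shows "\<exists>f\<in>maximizers. \<forall>j<d. f j = f 0"
proof -
  obtain f0 where f0: "f0 \<in> maximizers"
    using maximizers_nonempty[OF \<open>1 \<le> n\<close>] by blast
  define e where "e = f0 0"
  have e: "e \<in> carrier_vec n" "re_inner e e = 1"
    using f0 by (auto simp: maximizers_def e_def complex_unit_sphere_iff)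
  define \<Phi> where "\<Phi> = (\<lambda>f. \<Sum>k<d. re_inner e (f k))"
  obtain f where f: "f \<in> maximizers" and \<Phi>_le: "\<And>g. g \<in> maximizers \<Longrightarrow> \<Phi> g \<le> \<Phi> f"
    using best_aligned_maximizer[OF \<open>1 \<le> n\<close> e(1)] unfolding \<Phi>_def by blast
  have unit: "f k \<in> complex_unit_sphere n" and car: "f k \<in> carrier_vec n" for k
    using f by (auto simp: maximizers_def complex_unit_sphere_iff)
  have \<Phi>_upd: "\<Phi> (g(k := x)) = \<Phi> g - re_inner e (g k) + re_inner e x" if "k < d" for g k x
    using that by (simp add: \<Phi>_def sum.remove[of "{..<d}" k])
  have nonneg: "0 \<le> re_inner e (f k)" if "k < d" for k
    using \<Phi>_le[OF maximizers_flip[OF f that]] re_inner_scale_right[OF e(1) car[of k], of "-1"]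
    by (simp add: \<Phi>_upd[OF that])
  \<comment> \<open>After sign changes, \<open>f0\<close> has alignment at least 1, its entry 0 being \<open>e\<close> itself.\<close>
  have "0 < \<Phi> f"
  proof -
    obtain g where g: "g \<in> maximizers" "\<And>k. k < d \<Longrightarrow> re_inner e (g k) = \<bar>re_inner e (f0 k)\<bar>"
      using maximizer_in_half_space[OF f0 e(1), of d] by auto
    have "re_inner e (g 0) \<le> \<Phi> g"
      unfolding \<Phi>_def using \<open>1 \<le> d\<close> g(2) by (intro member_le_sum) auto
    then show ?thesis
      using \<Phi>_le[OF g(1)] g(2)[of 0] e(2) \<open>1 \<le> d\<close> by (simp add: e_def)
  qed
  then obtain p where p: "p < d" "0 < re_inner e (f p)"
    unfolding \<Phi>_def by (metis lessThan_iff not_less sum_nonpos)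
  have "f k = f p" if k: "k < d" for k
  proof (rule ccontr)
    assume ne: "f k \<noteq> f p"
    then have pk: "p \<noteq> k"
      by blast
    define s where "s = f p + f k"
    define r where "r = sqrt (re_inner s s)"
    define w where "w = complex_of_real (1 / r) \<cdot>\<^sub>v s"
    have s: "s \<in> carrier_vec n"
      using car by (simp add: s_def)
    have a: "re_inner e s = re_inner e (f p) + re_inner e (f k)"
      unfolding s_def by (rule re_inner_add_right[OF e(1) car car])
    then have a_pos: "0 < re_inner e s"
      using p nonneg[OF k] by simp
    have "s \<noteq> 0\<^sub>v n"
      using a_pos e(1) by (auto simp: re_inner_eq_sum[where n = n])
    then have s_pos: "0 < re_inner s s"
      using re_inner_self_nonneg[OF s] re_inner_self_eq_0_iff[OF s] by simp
    have "re_inner s s < 4"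
      unfolding s_def using ne by (intro norm_sum_of_distinct_units[OF unit unit]) simp
    then have r: "0 < r" "r < 2"
      using s_pos real_sqrt_less_mono[of "re_inner s s" 4] by (auto simp: r_def)
    have "w \<in> complex_unit_sphere n"
      unfolding w_def r_def by (rule normalize_in_complex_unit_sphere[OF s s_pos])
    moreover have "\<bar>F (f(p := w, k := w))\<bar> = \<bar>F f\<bar>"
      unfolding w_def r_def s_def using f s_pos
      by (intro merge_maximizer[OF p(1) k pk]) (simp_all add: maximizers_def s_def)
    ultimately have "f(p := w, k := w) \<in> maximizers"
      using f by (simp add: maximizers_def)
    then have "\<Phi> (f(p := w, k := w)) \<le> \<Phi> f"
      by (rule \<Phi>_le)
    then have "2 * re_inner e w \<le> re_inner e s"
      using pk by (simp add: \<Phi>_upd p(1) k a)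
    moreover have "re_inner e w = re_inner e s / r"
      unfolding w_def re_inner_scale_right[OF e(1) s] by simp
    \<comment> \<open>Impossible, since \<open>r\<close>, the norm of a sum of two distinct unit vectors, is less than 2.\<close>
    ultimately have "2 * re_inner e s \<le> r * re_inner e s"
      using r by (simp add: field_simps)
    then show False
      using a_pos r by simp
  qed
  then have "\<forall>j<d. f j = f 0"
    using \<open>1 \<le> d\<close> by simp
  then show ?thesis
    using f by blast
qed

end

section \<open>The form of a tensor on stacked vectors\<close>

lemma conj_stack_carrier [simp]: "x \<in> carrier_vec n \<Longrightarrow> conj_stack x \<in> carrier_vec (2 * n)"
  unfolding conj_stack_def mult_2 by (intro append_carrier_vec carrier_vec_conjugate)

lemma conj_stack_index:
  assumes "x \<in> carrier_vec n" "i < 2 * n"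
  shows "conj_stack x $ i = (if i < n then cnj (x $ i) else x $ (i - n))"
  using assms by (auto simp: conj_stack_def)

lemma conj_stack_add:
  assumes "x \<in> carrier_vec n" "y \<in> carrier_vec n"
  shows "conj_stack (x + y) = conj_stack x + conj_stack y"
  using assms by (intro eq_vecI) (auto simp: conj_stack_def)

lemma conj_stack_scale:
  "conj_stack (complex_of_real c \<cdot>\<^sub>v x) = complex_of_real c \<cdot>\<^sub>v conj_stack x"
  by (intro eq_vecI) (auto simp: conj_stack_def)

lemma multilinear_form_cong:
  assumes "\<And>k. k < d \<Longrightarrow> z k = z' k"
  shows "multilinear_form m d G z = multilinear_form m d G z'"
  unfolding multilinear_form_def using assms by simp

text \<open>The form as a linear functional of the vector in slot \<open>k\<close>, the coefficients being in parentheses.\<close>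

lemma multilinear_form_upd:
  assumes "k < d"
  shows "multilinear_form m d G (z(k := x)) =
    (\<Sum>i\<in>multi_indices m d. (G i * (\<Prod>l\<in>{..<d} - {k}. z l $ i l)) * x $ i k)"
proof -
  have "(\<Prod>l<d. (z(k := x)) l $ i l) = x $ i k * (\<Prod>l\<in>{..<d} - {k}. z l $ i l)" for i
    using assms by (simp add: prod.remove[of "{..<d}" k])
  then show ?thesis
    by (simp only: multilinear_form_def mult.assoc mult.commute[of "x $ _"])
qed

lemma multilinear_form_add:
  assumes "k < d" "x \<in> carrier_vec m" "y \<in> carrier_vec m"
  shows "multilinear_form m d G (z(k := x + y)) =
    multilinear_form m d G (z(k := x)) + multilinear_form m d G (z(k := y))"
proof -
  have "(x + y) $ i k = x $ i k + y $ i k" if "i \<in> multi_indices m d" for i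
    using that assms by (intro index_add_vec) (auto simp: multi_indices_def)
  then show ?thesis
    using assms(1) by (simp add: multilinear_form_upd distrib_left flip: sum.distrib)
qed

lemma multilinear_form_scale:
  assumes "k < d" "x \<in> carrier_vec m"
  shows "multilinear_form m d G (z(k := c \<cdot>\<^sub>v x)) = c * multilinear_form m d G (z(k := x))"
proof -
  have "(c \<cdot>\<^sub>v x) $ i k = c * x $ i k" if "i \<in> multi_indices m d" for i
    using that assms by (intro index_smult_vec) (auto simp: multi_indices_def)
  then show ?thesis
    using assms(1) by (simp add: multilinear_form_upd sum_distrib_left mult.left_commute)
qed

text \<open>
  Permuting the arguments amounts to permuting the index, after the summation has been
  reindexed by \<open>i \<mapsto> i \<circ> p\<close>.
\<close>

lemma multilinear_form_permute:
  assumes p: "p permutes {..<d}"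
    and sym: "\<And>i. i \<in> multi_indices m d \<Longrightarrow> G (i \<circ> p) = G i"
  shows "multilinear_form m d G (z \<circ> p) = multilinear_form m d G z"
proof -
  have closed: "i \<circ> q \<in> multi_indices m d" if "i \<in> multi_indices m d" "q permutes {..<d}" for i q
    using that permutes_in_image[OF that(2)] permutes_not_in[OF that(2)]
    by (fastforce simp: multi_indices_def PiE_iff extensional_def)
  have bij: "bij_betw (\<lambda>i. i \<circ> p) (multi_indices m d) (multi_indices m d)"
    using closed p permutes_inv[OF p]
    by (intro bij_betw_byWitness[where f' = "\<lambda>i. i \<circ> inv_into UNIV p"])
       (auto simp: o_assoc[symmetric] permutes_inv_o)
  have "multilinear_form m d G (z \<circ> p) =
      (\<Sum>i\<in>multi_indices m d. G (i \<circ> p) * (\<Prod>k<d. z (p k) $ i (p k)))"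
    unfolding multilinear_form_def using sum.reindex_bij_betw[OF bij,
        of "\<lambda>i. G i * (\<Prod>k<d. z (p k) $ i k)"] by simp
  also have "\<dots> = (\<Sum>i\<in>multi_indices m d. G i * (\<Prod>k<d. z k $ i k))"
  proof (rule sum.cong[OF refl])
    fix i assume i: "i \<in> multi_indices m d"
    show "G (i \<circ> p) * (\<Prod>k<d. z (p k) $ i (p k)) = G i * (\<Prod>k<d. z k $ i k)"
      using prod.permute[OF p, of "\<lambda>k. z k $ i k"] unfolding sym[OF i] by (simp add: o_def)
  qed
  finally show ?thesis
    by (simp add: multilinear_form_def)
qed

text \<open>
  The involution \<open>\<sigma>\<close> exchanges the two halves of the index range. Applied to all positions of a
  multi-index, it conjugates the entry of \<open>G\<close> as well as each coordinate of a stacked vector; so it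
  turns the sum that defines the form into the conjugate sum.
\<close>

lemma multilinear_form_conj_stack_real:
  assumes G: "conjugate_super_symmetric n d G" and x: "\<And>k. k < d \<Longrightarrow> x k \<in> carrier_vec n"
  shows "multilinear_form (2 * n) d G (\<lambda>k. conj_stack (x k)) \<in> \<real>"
proof -
  define \<sigma> where "\<sigma> = (\<lambda>a. if a < n then a + n else a - n)"
  define \<tau> where "\<tau> = (\<lambda>i :: nat \<Rightarrow> nat. \<lambda>k\<in>{..<d}. \<sigma> (i k))"
  let ?I = "multi_indices (2 * n) d"
  let ?z = "\<lambda>k. conj_stack (x k)"
  have \<sigma>: "\<sigma> a < 2 * n" "\<sigma> (\<sigma> a) = a" "\<bar>int a - int (\<sigma> a)\<bar> = int n" if "a < 2 * n" for a
    using that by (auto simp: \<sigma>_def)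
  have less: "i k < 2 * n" if "i \<in> ?I" "k < d" for i k
    using that by (auto simp: multi_indices_def)
  have \<tau>_closed: "\<tau> i \<in> ?I" if "i \<in> ?I" for i
    using less[OF that] \<sigma>(1) by (auto simp: \<tau>_def multi_indices_def)
  have \<tau>_\<tau>: "\<tau> (\<tau> i) = i" if "i \<in> ?I" for i
    using less[OF that] \<sigma>(2) that
    by (auto simp: \<tau>_def multi_indices_def PiE_iff extensional_def fun_eq_iff)
  have bij: "bij_betw \<tau> ?I ?I"
    using \<tau>_closed \<tau>_\<tau> by (intro bij_betw_byWitness[where f' = \<tau>]) auto
  have cnj_G: "cnj (G (\<tau> i)) = G i" if i: "i \<in> ?I" for i
  proof -
    have "\<forall>k<d. \<bar>int (i k) - int (\<tau> i k)\<bar> = int n"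
      using less[OF i] \<sigma>(3) by (simp add: \<tau>_def)
    then show ?thesis
      using G i \<tau>_closed[OF i] unfolding conjugate_super_symmetric_def by metis
  qed
  have cnj_z: "cnj (?z k $ \<tau> i k) = ?z k $ i k" if "i \<in> ?I" "k < d" for i k
    using less[OF that] \<sigma>(1)[OF less[OF that]] that x
    by (auto simp: conj_stack_index[where n = n] \<tau>_def) (auto simp: \<sigma>_def)
  have "cnj (multilinear_form (2 * n) d G ?z) =
      (\<Sum>i\<in>?I. cnj (G i) * (\<Prod>k<d. cnj (?z k $ i k)))"
    by (simp add: multilinear_form_def)
  also have "\<dots> = (\<Sum>i\<in>?I. cnj (G (\<tau> i)) * (\<Prod>k<d. cnj (?z k $ \<tau> i k)))"
    by (rule sum.reindex_bij_betw[OF bij, symmetric])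
  also have "\<dots> = multilinear_form (2 * n) d G ?z"
    unfolding multilinear_form_def by (intro sum.cong) (auto simp: cnj_G cnj_z)
  finally show ?thesis
    by (simp add: Reals_cnj_iff)
qed

lemma symmetric_real_form_conj_stack:
  assumes G: "conjugate_super_symmetric n d G"
  shows "symmetric_real_form n d (\<lambda>f. Re (multilinear_form (2 * n) d G (\<lambda>k. conj_stack (f k))))"
proof
  have upd: "(\<lambda>l. conj_stack ((f(k := v)) l)) = (\<lambda>l. conj_stack (f l))(k := conj_stack v)"
    for f :: "nat \<Rightarrow> complex vec" and k v
    by auto
  fix f k and x y :: "complex vec" and c
  assume k: "k < d" and x: "x \<in> carrier_vec n"
  show "Re (multilinear_form (2 * n) d G (\<lambda>l. conj_stack ((f(k := complex_of_real c \<cdot>\<^sub>v x)) l))) =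
      c * Re (multilinear_form (2 * n) d G (\<lambda>l. conj_stack ((f(k := x)) l)))"
    unfolding upd conj_stack_scale using k x
    by (subst multilinear_form_scale) auto
  assume y: "y \<in> carrier_vec n"
  show "Re (multilinear_form (2 * n) d G (\<lambda>l. conj_stack ((f(k := x + y)) l))) =
      Re (multilinear_form (2 * n) d G (\<lambda>l. conj_stack ((f(k := x)) l))) +
      Re (multilinear_form (2 * n) d G (\<lambda>l. conj_stack ((f(k := y)) l)))"
    unfolding upd conj_stack_add[OF x y] using k x y
    by (subst multilinear_form_add) auto
next
  fix f and j k :: nat and x y :: "complex vec"
  assume jk: "j < d" "k < d" "j \<noteq> k"
  have "transpose j k permutes {..<d}"
    using jk by (intro permutes_swap_id) auto
  then have "multilinear_form (2 * n) d G ((\<lambda>l. conj_stack ((f(j := x, k := y)) l)) \<circ> transpose j k) =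
      multilinear_form (2 * n) d G (\<lambda>l. conj_stack ((f(j := x, k := y)) l))"
    using G by (intro multilinear_form_permute) (auto simp: conjugate_super_symmetric_def)
  moreover have "(\<lambda>l. conj_stack ((f(j := x, k := y)) l)) \<circ> transpose j k =
      (\<lambda>l. conj_stack ((f(j := y, k := x)) l))"
    using jk by (auto simp: fun_eq_iff transpose_def)
  ultimately show "Re (multilinear_form (2 * n) d G (\<lambda>l. conj_stack ((f(j := x, k := y)) l))) =
      Re (multilinear_form (2 * n) d G (\<lambda>l. conj_stack ((f(j := y, k := x)) l)))"
    by simp
next
  have "continuous_on UNIV (\<lambda>X :: nat \<Rightarrow> nat \<Rightarrow> complex. conj_stack (vec n (X k)) $ i k)"
    if "i \<in> multi_indices (2 * n) d" "k < d" for i k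
  proof -
    have "i k < 2 * n"
      using that by (auto simp: multi_indices_def)
    then have "conj_stack (vec n (X k)) $ i k =
        (if i k < n then cnj (X k (i k)) else X k (i k - n))" for X :: "nat \<Rightarrow> nat \<Rightarrow> complex"
      by (auto simp: conj_stack_index[where n = n])
    then show ?thesis
      by (cases "i k < n") (simp_all add: continuous_on_cnj continuous_on_coordinate)
  qed
  then show "continuous_on UNIV
      (\<lambda>X. Re (multilinear_form (2 * n) d G (\<lambda>k. conj_stack (vec n (X k)))))"
    unfolding multilinear_form_def
    by (intro continuous_on_Re continuous_on_sum continuous_on_mult continuous_on_const
        continuous_on_prod) simp
qed

section \<open>Conjugate super-symmetric tensors\<close>

theorem theorem5p2:
  fixes n d :: nat and G :: "(nat \<Rightarrow> nat) \<Rightarrow> complex"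
  assumes "1 \<le> n" and "1 \<le> d"
    and "conjugate_super_symmetric n d G"
  shows "\<exists>M.
    is_maximum
      {cmod (multilinear_form (2 * n) d G (\<lambda>k. conj_stack x)) | x.
        x \<in> complex_unit_sphere n} M \<and>
    is_maximum
      {Re (multilinear_form (2 * n) d G (\<lambda>k. conj_stack (x k))) | x.
        \<forall>k<d. x k \<in> complex_unit_sphere n} M"
proof -
  define F where "F = (\<lambda>f. Re (multilinear_form (2 * n) d G (\<lambda>k. conj_stack (f k))))"
  interpret symmetric_real_form n d F
    unfolding F_def by (rule symmetric_real_form_conj_stack) fact
  have F_cong: "F f = F g" if "\<And>k. k < d \<Longrightarrow> f k = g k" for f g
    unfolding F_def using that by (intro arg_cong[of _ _ Re] multilinear_form_cong) simp
  obtain f where f: "f \<in> maximizers" "\<forall>j<d. f j = f 0"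
    using constant_maximizer[OF assms(1,2)] by (rule bexE)
  define x where "x = f 0"
  define M where "M = \<bar>F (\<lambda>_. x)\<bar>"
  have x: "x \<in> complex_unit_sphere n"
    using f(1) by (simp add: maximizers_def x_def)
  have "F f = F (\<lambda>_. x)"
    unfolding x_def using f(2) by (intro F_cong) blast
  then have Ff: "\<bar>F f\<bar> = M"
    by (simp add: M_def)
  have bound: "\<bar>F g\<bar> \<le> M" if "\<forall>k<d. g k \<in> complex_unit_sphere n" for g
  proof -
    have "F g = F (\<lambda>k. if k < d then g k else x)"
      by (rule F_cong) simp
    then show ?thesis
      using f(1) that x Ff by (simp add: maximizers_def)
  qed
  have diagonal: "cmod (multilinear_form (2 * n) d G (\<lambda>k. conj_stack y)) = \<bar>F (\<lambda>_. y)\<bar>"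
    if "y \<in> complex_unit_sphere n" for y
    using multilinear_form_conj_stack_real[OF assms(3), of "\<lambda>_. y"] that
    by (simp add: complex_unit_sphere_iff F_def in_Reals_norm complex_is_Real_iff cmod_eq_Re)
  \<comment> \<open>A negative value at the constant tuple becomes positive when the entry in slot 0 is negated.\<close>
  have attained: "\<exists>g. (\<forall>k<d. g k \<in> complex_unit_sphere n) \<and> F g = M"
  proof (cases "0 \<le> F (\<lambda>_. x)")
    case True
    then show ?thesis
      using x by (intro exI[of _ "\<lambda>_. x"]) (simp add: M_def)
  next
    case False
    define g where "g = (\<lambda>_. x)((0::nat) := complex_of_real (-1) \<cdot>\<^sub>v x)"
    have "F g = - F (\<lambda>_. x)"
      using scale[of 0 x "\<lambda>_. x" "-1"] assms(2) x
      by (simp add: g_def complex_unit_sphere_iff fun_upd_idem)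
    then show ?thesis
      using False x complex_unit_sphere_uminus[OF x] by (intro exI[of _ g]) (simp add: g_def M_def)
  qed
  have "is_maximum {cmod (multilinear_form (2 * n) d G (\<lambda>k. conj_stack x)) | x.
        x \<in> complex_unit_sphere n} M"
    unfolding is_maximum_def
  proof (intro conjI ballI)
    have "M = cmod (multilinear_form (2 * n) d G (\<lambda>k. conj_stack x))"
      by (simp add: M_def diagonal[OF x])
    then show "M \<in> {cmod (multilinear_form (2 * n) d G (\<lambda>k. conj_stack x)) | x.
        x \<in> complex_unit_sphere n}"
      using x by blast
    fix v assume "v \<in> {cmod (multilinear_form (2 * n) d G (\<lambda>k. conj_stack x)) | x.
        x \<in> complex_unit_sphere n}"
    then obtain y where "y \<in> complex_unit_sphere n" "v = \<bar>F (\<lambda>_. y)\<bar>"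
      using diagonal by blast
    then show "v \<le> M"
      using bound[of "\<lambda>_. y"] by simp
  qed
  moreover have "is_maximum {F x | x. \<forall>k<d. x k \<in> complex_unit_sphere n} M"
    unfolding is_maximum_def
  proof (intro conjI ballI)
    show "M \<in> {F x | x. \<forall>k<d. x k \<in> complex_unit_sphere n}"
      using attained by blast
    fix v assume "v \<in> {F x | x. \<forall>k<d. x k \<in> complex_unit_sphere n}"
    then obtain g where "\<forall>k<d. g k \<in> complex_unit_sphere n" "v = F g"
      by blast
    then show "v \<le> M"
      using bound[of g] by simp
  qed
  ultimately show ?thesis
    unfolding F_def by blast
qed

end
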